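(* Let $N\ge2$, let $G=([N-1],E,(\omega_{x,y})_{\{x,y\}\in E})$ be a finite connected graph with symmetric conductances $\omega_{x,y}\in(0,\infty)$, let $\omega_L,\omega_R>0$, and let $(\xi_t)_{t\ge0}$ be the associated dual boundary driven exclusion process. For all integers $1\le x_1<\dots<x_n\le N-1$ and $0\le\ell\le n$, $$\hat{\mathbb P}_{\{x_1,\dots,x_n\}}\big(\xi_\infty(N)=\ell\big)=\sum_{k=\ell}^n(-1)^{k-\ell}\binom{k}{\ell}\sum_{1\le i_1<\dots<i_k\le n}\hat{\mathbb P}_{\{x_{i_1},\dots,x_{i_k}\}}\big(\xi_\infty(N)=k\big).$$
   Context: $[N-1]:=\{1,\dots,N-1\}$. The dual boundary driven (symmetric) exclusion process is the Markov process $(\xi_t)_{t\ge0}$ on $\hat{\mathcal X}=\mathbb N_0^{\{0\}}\times\{0,1\}^{[N-1]}\times\mathbb N_0^{\{N\}}$ with generator $$\hat{\mathcal L}f(\xi)=\sum_{\{x,y\}\in E}\omega_{x,y}\big\{\xi(x)(1-\xi(y))(f(\xi^{x,y})-f(\xi))+\xi(y)(1-\xi(x))(f(\xi^{y,x})-f(\xi))\big\}$$ $$+\ \omega_L\,\xi(1)(f(\xi^{1,0})-f(\xi))+\omega_R\,\xi(N-1)(f(\xi^{N-1,N})-f(\xi)),$$ where $\xi^{x,y}$ is $\xi$ with one particle moved from $x$ to $y$. Thus particles in the bulk $[N-1]$ follow the exclusion dynamics and the sites $0,N$ are absorbing. For $J\subset[N-1]$, $\hat{\mathbb P}_J$ is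 the law of the process started from $\xi_0(x)=\mathbf 1_{\{x\in J\}}$. All particles are eventually absorbed almost surely, and $\xi_\infty:=\lim_{t\to\infty}\xi_t$; $\xi_\infty(N)$ is the number of particles absorbed at $N$. For $k=0$ the inner sum is the single term $\hat{\mathbb P}_\emptyset(\xi_\infty(N)=0)=1$. *)

theory Defs
  imports "HOL-Probability.Probability"
begin

text \<open>
  A time-homogeneous Markov process in continuous time on a countable state space \<open>S\<close>,
  given as a family of laws \<open>P x\<close> (the process \<open>X\<close> starts from \<open>x\<close> under \<open>P x\<close>).
\<close>

definition natural_history ::
    "'s set \<Rightarrow> 'w measure \<Rightarrow> (real \<Rightarrow> 'w \<Rightarrow> 's) \<Rightarrow> real \<Rightarrow> 'w measure" where
  "natural_history S M X s =
     sigma (space M) {X r -` {y} \<inter> space M | r y. r \<in> {0..s} \<and> y \<in> S}"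

text \<open>
  Right-continuity is with respect to the discrete topology on \<open>S\<close>: paths
  are locally constant to the right.
\<close>

definition markov_process ::
    "'s set \<Rightarrow> ('s \<Rightarrow> 'w measure) \<Rightarrow> (real \<Rightarrow> 'w \<Rightarrow> 's) \<Rightarrow> bool" where
  "markov_process S P X \<longleftrightarrow>
     (\<forall>x\<in>S. prob_space (P x)) \<and>
     (\<forall>x\<in>S. \<forall>t\<ge>0. X t \<in> measurable (P x) (count_space S)) \<and>
     (\<forall>x\<in>S. \<forall>\<omega>\<in>space (P x). \<forall>t\<ge>0. \<forall>\<^sub>F s in at_right t. X s \<omega> = X t \<omega>) \<and>
     (\<forall>x\<in>S. AE \<omega> in P x. X 0 \<omega> = x) \<and>
     (\<forall>x\<in>S. \<forall>s\<ge>0. \<forall>t\<ge>0. \<forall>f :: 's \<Rightarrow> real. bounded (f ` S) \<longrightarrow>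
        (AE \<omega> in P x. real_cond_exp (P x) (natural_history S (P x) X s) (\<lambda>\<omega>'. f (X (s + t) \<omega>')) \<omega>
                       = (\<integral>\<omega>'. f (X t \<omega>') \<partial>P (X s \<omega>))))"

text \<open>
  The generator is the derivative at time 0 of the transition semigroup on bounded
  functions. Pointwise convergence is the weakest reading; it determines the process
  when, as for the generator below, the jump rates are bounded.
\<close>

definition has_generator ::
    "'s set \<Rightarrow> ('s \<Rightarrow> 'w measure) \<Rightarrow> (real \<Rightarrow> 'w \<Rightarrow> 's) \<Rightarrow> (('s \<Rightarrow> real) \<Rightarrow> 's \<Rightarrow> real) \<Rightarrow> bool" where
  "has_generator S P X L \<longleftrightarrow>
     (\<forall>f :: 's \<Rightarrow> real. bounded (f ` S) \<longrightarrow>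
        (\<forall>x\<in>S. ((\<lambda>t. ((\<integral>\<omega>. f (X t \<omega>) \<partial>P x) - f x) / t) \<longlongrightarrow> L f x) (at_right 0)))"

definition conductance_graph :: "nat \<Rightarrow> nat set set \<Rightarrow> (nat \<Rightarrow> nat \<Rightarrow> real) \<Rightarrow> bool" where
  "conductance_graph N E w \<longleftrightarrow>
     E \<subseteq> {{x, y} | x y. x \<in> {1..N-1} \<and> y \<in> {1..N-1} \<and> x \<noteq> y} \<and>
     (\<forall>x\<in>{1..N-1}. \<forall>y\<in>{1..N-1}. (x, y) \<in> {(a, b). {a, b} \<in> E}\<^sup>*) \<and>
     (\<forall>x y. {x, y} \<in> E \<longrightarrow> 0 < w x y \<and> w x y = w y x)"

type_synonym config = "nat \<Rightarrow> nat"

text \<open>Configurations live on the sites \<open>0, \<dots>, N\<close> and are extended by 0 to all of \<open>nat\<close>.\<close>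

definition dual_configs :: "nat \<Rightarrow> config set" where
  "dual_configs N = {\<xi>. (\<forall>x\<in>{1..N-1}. \<xi> x \<le> 1) \<and> (\<forall>x>N. \<xi> x = 0)}"

text \<open>
  Only meaningful if \<open>x \<noteq> y\<close> and \<open>\<xi> x > 0\<close>; in the generator every other instance
  comes with rate 0.
\<close>

definition move :: "config \<Rightarrow> nat \<Rightarrow> nat \<Rightarrow> config" where
  "move \<xi> x y = \<xi>(x := \<xi> x - 1, y := \<xi> y + 1)"

text \<open>
  Each unordered edge contributes once: it is represented by its ordered pair \<open>x < y\<close>,
  the summand being symmetric in \<open>x\<close> and \<open>y\<close>.
\<close>

definition dual_generator ::
    "nat \<Rightarrow> nat set set \<Rightarrow> (nat \<Rightarrow> nat \<Rightarrow> real) \<Rightarrow> real \<Rightarrow> real \<Rightarrow> (config \<Rightarrow> real) \<Rightarrow> config \<Rightarrow> real" where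
  "dual_generator N E w wL wR f \<xi> =
     (\<Sum>(x, y) \<in> {(x, y). x < y \<and> {x, y} \<in> E}.
        w x y * (real (\<xi> x) * (1 - real (\<xi> y)) * (f (move \<xi> x y) - f \<xi>)
               + real (\<xi> y) * (1 - real (\<xi> x)) * (f (move \<xi> y x) - f \<xi>)))
     + wL * real (\<xi> 1) * (f (move \<xi> 1 0) - f \<xi>)
     + wR * real (\<xi> (N - 1)) * (f (move \<xi> (N - 1) N) - f \<xi>)"

definition dual_exclusion_process ::
    "nat \<Rightarrow> nat set set \<Rightarrow> (nat \<Rightarrow> nat \<Rightarrow> real) \<Rightarrow> real \<Rightarrow> real \<Rightarrow>
     (config \<Rightarrow> 'w measure) \<Rightarrow> (real \<Rightarrow> 'w \<Rightarrow> config) \<Rightarrow> bool" where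
  "dual_exclusion_process N E w wL wR P \<xi> \<longleftrightarrow>
     markov_process (dual_configs N) P \<xi> \<and>
     has_generator (dual_configs N) P \<xi> (dual_generator N E w wL wR)"

definition law_from :: "(config \<Rightarrow> 'w measure) \<Rightarrow> nat set \<Rightarrow> 'w measure" where
  "law_from P J = P (indicator J)"

text \<open>The limit of configurations is taken site by site (\<open>nat\<close> being discrete).\<close>

definition limit_config :: "(real \<Rightarrow> 'w \<Rightarrow> config) \<Rightarrow> 'w \<Rightarrow> config" where
  "limit_config \<xi> \<omega> = (\<lambda>x. Lim at_top (\<lambda>t. \<xi> t \<omega> x))"

end

theory Submission
  imports Defs
begin

text \<open>
  Inclusion-exclusion would give the formula at once if the particles were independent. They are
  not, but the symmetric exclusion process is consistent: a sub-family of the particles evolves in law like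
  the process started from that sub-family alone. Hence the sum over all \<open>k\<close>-subsets \<open>I\<close> of the probability
  that all particles started from \<open>I\<close> end up at \<open>N\<close> is the expectation of \<open>\<xi>\<^sub>\<infinity>(N) choose k\<close>, and the
  probability of \<open>\<xi>\<^sub>\<infinity>(N) = l\<close> is recovered from these binomial moments by binomial inversion.

  The proof below expresses this through harmonic functions, without constructing a coupling. Let
  \<open>g\<^sub>k(\<eta>)\<close> be the probability that \<open>k\<close> particles are absorbed at \<open>N\<close> when the process starts from \<open>\<eta>\<close>. The
  number of particles at \<open>N\<close> is almost surely nondecreasing and bounded, so \<open>g\<^sub>k\<close> is a limit of probabilities of
  one-time events; therefore it is invariant under the semigroup and annihilated by the generator
  (\<open>absorption_prob_harmonic\<close>). The monotonicity, and the fact that a configuration without bulk particles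
  stays put, both come from one observation: a finite set on which its indicator function has zero
  generator is almost surely never left (\<open>closed_set_never_left\<close>).

  In the stirring representation (\<open>dual_generator_stirring\<close>) every jump applies a map of sites, an
  interchange of two neighbours or an absorption, at a rate that does not depend on the configuration.
  Applied to labelled particles, the same site map moves every sub-family correctly, so for
  every sub-family the absorption probability is harmonic for one and the same stirring operator on
  labelled configurations, and by linearity so are both sides of the claimed formula. The
  graph is connected and the absorption rate is positive, so a harmonic function is determined
  by its values on configurations with all particles absorbed (\<open>maximum_principle\<close>). There the formula is the
  alternating sum \<open>binomial_inversion_Pow\<close>.
\<close>

section \<open>Markov semigroups and closed sets\<close>

definition transition_expectation ::
    "('s \<Rightarrow> 'w measure) \<Rightarrow> (real \<Rightarrow> 'w \<Rightarrow> 's) \<Rightarrow> real \<Rightarrow> ('s \<Rightarrow> real) \<Rightarrow> 's \<Rightarrow> real" where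
  "transition_expectation P X t f x = (\<integral>\<omega>. f (X t \<omega>) \<partial>P x)"

lemma markov_process_prob_space: "markov_process S P X \<Longrightarrow> x \<in> S \<Longrightarrow> prob_space (P x)"
  by (simp add: markov_process_def)

lemma markov_process_measurable:
  "markov_process S P X \<Longrightarrow> x \<in> S \<Longrightarrow> 0 \<le> t \<Longrightarrow> X t \<in> measurable (P x) (count_space S)"
  by (simp add: markov_process_def)

lemma markov_process_in_space:
  assumes "markov_process S P X" "x \<in> S" "0 \<le> t" "\<omega> \<in> space (P x)"
  shows "X t \<omega> \<in> S"
  using measurable_space[OF markov_process_measurable[OF assms(1-3)] assms(4)] by simp

lemma markov_process_borel_measurable:
  assumes "markov_process S P X" "x \<in> S" "0 \<le> t"
  shows "(\<lambda>\<omega>. f (X t \<omega>) :: real) \<in> borel_measurable (P x)"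
  by (rule measurable_compose[OF markov_process_measurable[OF assms]]) simp

lemma markov_process_integrable:
  fixes f :: "'s \<Rightarrow> real"
  assumes "markov_process S P X" "x \<in> S" "0 \<le> t" "bounded (f ` S)"
  shows "integrable (P x) (\<lambda>\<omega>. f (X t \<omega>))"
proof -
  interpret prob_space "P x" by (rule markov_process_prob_space[OF assms(1,2)])
  obtain b where "\<And>y. y \<in> S \<Longrightarrow> norm (f y) \<le> b"
    using assms(4) by (auto simp: bounded_iff)
  then have "AE \<omega> in P x. norm (f (X t \<omega>)) \<le> b"
    using markov_process_in_space[OF assms(1-3)] by (intro AE_I2) blast
  then show ?thesis
    by (rule integrable_const_bound) (rule markov_process_borel_measurable[OF assms(1-3)])
qed

lemma transition_expectation_bounds:
  assumes "markov_process S P X" "x \<in> S" "0 \<le> t" "\<And>y. y \<in> S \<Longrightarrow> a \<le> f y \<and> f y \<le> b"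
  shows "a \<le> transition_expectation P X t f x \<and> transition_expectation P X t f x \<le> b"
proof -
  interpret prob_space "P x" by (rule markov_process_prob_space[OF assms(1,2)])
  have "bounded (f ` S)"
    using assms(4) by (intro boundedI[where B="\<bar>a\<bar> + \<bar>b\<bar>"]) fastforce
  from markov_process_integrable[OF assms(1-3) this]
  have "integrable (P x) (\<lambda>\<omega>. f (X t \<omega>))" .
  moreover have "AE \<omega> in P x. a \<le> f (X t \<omega>)" "AE \<omega> in P x. f (X t \<omega>) \<le> b"
    using markov_process_in_space[OF assms(1-3)] assms(4) by (blast intro: AE_I2)+
  ultimately show ?thesis unfolding transition_expectation_def
    using integral_ge_const integral_le_const by blast
qed

lemma bounded_transition_expectation:
  assumes "markov_process S P X" "0 \<le> t" "bounded (f ` S)"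
  shows "bounded (transition_expectation P X t f ` S)"
proof -
  obtain b where b: "\<And>y. y \<in> S \<Longrightarrow> norm (f y) \<le> b"
    using assms(3) by (auto simp: bounded_iff)
  have "norm (transition_expectation P X t f y) \<le> b" if "y \<in> S" for y
    using transition_expectation_bounds[OF assms(1) that assms(2), of "-b" f b] b
    by (auto simp: abs_le_iff minus_le_iff)
  then show ?thesis by (auto simp: bounded_iff)
qed

text \<open>
  The Markov property as an identity between integrals. Countability of the state space makes
  every function of \<open>X s\<close> measurable with respect to the history up to time \<open>s\<close>, because the
  history is generated by the events \<open>X r = y\<close>.
\<close>

lemma markov_property_weighted:
  fixes f h :: "'s \<Rightarrow> real"
  assumes mp: "markov_process S P X" and "countable S" and x: "x \<in> S" and st: "0 \<le> s" "0 \<le> t"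
    and f: "bounded (f ` S)" and h: "bounded (h ` S)"
  shows "(\<integral>\<omega>. h (X s \<omega>) * f (X (s + t) \<omega>) \<partial>P x)
       = (\<integral>\<omega>. h (X s \<omega>) * transition_expectation P X t f (X s \<omega>) \<partial>P x)"
proof -
  interpret prob_space "P x" by (rule markov_process_prob_space[OF mp x])
  define F where "F = natural_history S (P x) X s"
  have gen: "{X r -` {y} \<inter> space (P x) | r y. r \<in> {0..s} \<and> y \<in> S} \<subseteq> sets (P x)"
    using markov_process_measurable[OF mp x] by (auto intro: measurable_sets)
  have setsF: "sets F = sigma_sets (space (P x)) {X r -` {y} \<inter> space (P x) | r y. r \<in> {0..s} \<and> y \<in> S}"
    unfolding F_def natural_history_def by (rule sets_measure_of) auto
  have sub: "subalgebra (P x) F"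
    unfolding subalgebra_def setsF using sets.sigma_sets_subset[OF gen]
    by (simp add: F_def natural_history_def space_measure_of_conv)
  interpret fin: finite_measure_subalgebra "P x" F
    by unfold_locales (fact sub)
  have spF: "space F = space (P x)" by (simp add: F_def natural_history_def space_measure_of_conv)
  have XsF: "X s \<in> measurable F (count_space S)"
    unfolding measurable_count_space_eq_countable[OF \<open>countable S\<close>] spF
  proof safe
    fix \<omega> assume "\<omega> \<in> space (P x)" then show "X s \<omega> \<in> S"
      using markov_process_in_space[OF mp x st(1)] by blast
  next
    fix y assume "y \<in> S"
    then have "X s -` {y} \<inter> space (P x) \<in> {X r -` {y} \<inter> space (P x) | r y. r \<in> {0..s} \<and> y \<in> S}"
      using st by auto
    then show "X s -` {y} \<inter> space (P x) \<in> sets F"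
      unfolding setsF by (rule sigma_sets.Basic)
  qed
  have hF: "(\<lambda>\<omega>. h (X s \<omega>)) \<in> borel_measurable F"
    by (rule measurable_compose[OF XsF]) simp
  obtain a b where ab: "\<And>y. y \<in> S \<Longrightarrow> norm (f y) \<le> a" "\<And>y. y \<in> S \<Longrightarrow> norm (h y) \<le> b"
    using f h by (auto simp: bounded_iff)
  have int: "integrable (P x) (\<lambda>\<omega>. h (X s \<omega>) * f (X (s + t) \<omega>))"
  proof (rule integrable_const_bound[where B="b * a"])
    show "AE \<omega> in P x. norm (h (X s \<omega>) * f (X (s + t) \<omega>)) \<le> b * a"
      using markov_process_in_space[OF mp x] st ab
      by (intro AE_I2) (auto simp: abs_mult intro!: mult_mono' order_trans[OF norm_ge_zero ab(2)])
  qed (use st in \<open>intro borel_measurable_times markov_process_borel_measurable[OF mp x]; simp\<close>)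
  have "(\<integral>\<omega>. h (X s \<omega>) * f (X (s + t) \<omega>) \<partial>P x)
      = (\<integral>\<omega>. h (X s \<omega>) * real_cond_exp (P x) F (\<lambda>\<omega>'. f (X (s + t) \<omega>')) \<omega> \<partial>P x)"
    using fin.real_cond_exp_intg(2)[OF int hF markov_process_borel_measurable[OF mp x]] st by simp
  also have "\<dots> = (\<integral>\<omega>. h (X s \<omega>) * transition_expectation P X t f (X s \<omega>) \<partial>P x)"
  proof (rule integral_cong_AE)
    have "AE \<omega> in P x. real_cond_exp (P x) F (\<lambda>\<omega>'. f (X (s + t) \<omega>')) \<omega>
        = transition_expectation P X t f (X s \<omega>)"
      using mp x st f unfolding markov_process_def F_def transition_expectation_def by blast
    then show "AE \<omega> in P x. h (X s \<omega>) * real_cond_exp (P x) F (\<lambda>\<omega>'. f (X (s + t) \<omega>')) \<omega>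
        = h (X s \<omega>) * transition_expectation P X t f (X s \<omega>)"
      by eventually_elim simp
    show "(\<lambda>\<omega>. h (X s \<omega>) * real_cond_exp (P x) F (\<lambda>\<omega>'. f (X (s + t) \<omega>')) \<omega>) \<in> borel_measurable (P x)"
      by (intro borel_measurable_times markov_process_borel_measurable[OF mp x st(1)]) simp
    show "(\<lambda>\<omega>. h (X s \<omega>) * transition_expectation P X t f (X s \<omega>)) \<in> borel_measurable (P x)"
      using markov_process_borel_measurable[OF mp x st(1), of "\<lambda>y. h y * transition_expectation P X t f y"] .
  qed
  finally show ?thesis .
qed

lemma transition_semigroup:
  assumes "markov_process S P X" "countable S" "x \<in> S" "0 \<le> s" "0 \<le> t" "bounded (f ` S)"
  shows "transition_expectation P X (s + t) f x
       = transition_expectation P X s (transition_expectation P X t f) x"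
  using markov_property_weighted[OF assms, of "\<lambda>_. 1"]
  by (simp add: transition_expectation_def image_constant_conv)

lemma bounded_indicator_image: "bounded ((indicator C :: 's \<Rightarrow> real) ` S)"
  by (intro boundedI[where B=1]) (auto simp: indicator_def)

text \<open>
  For \<open>y \<in> C\<close> let \<open>q t y\<close> be the probability of being outside \<open>C\<close> at time \<open>t\<close>, and let \<open>e t\<close> be
  the sum of \<open>q t y\<close> over the finite set \<open>C\<close>. To be outside \<open>C\<close> at time \<open>s + t\<close>, the process is
  either outside at time \<open>s\<close>, or inside at time \<open>s\<close> and outside after a further time \<open>t\<close>.
  Hence \<open>q (k * t) y \<le> k * e t\<close> for every \<open>k\<close>. Since the generator gives \<open>e h = o(h)\<close>, cutting a fixed
  time \<open>t\<close> into more and more pieces forces \<open>q t y = 0\<close>.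
\<close>

lemma closed_set_never_left:
  assumes mp: "markov_process S P X" and "countable S" and gen: "has_generator S P X L"
    and C: "finite C" "C \<subseteq> S" and closed: "\<And>y. y \<in> C \<Longrightarrow> L (indicator C) y = 0"
    and x: "x \<in> C" and t: "0 \<le> t"
  shows "transition_expectation P X t (indicator C) x = 1"
proof -
  define q where "q t y = 1 - transition_expectation P X t (indicator C) y" for t y
  \<comment> \<open>A bound for all \<open>q t y\<close> with \<open>y \<in> C\<close> that is still \<open>o(t)\<close>, because \<open>C\<close> is finite.\<close>
  define e where "e t = (\<Sum>y\<in>C. q t y)" for t
  have q01: "0 \<le> q t y" "q t y \<le> 1" if "y \<in> S" "0 \<le> t" for t y
    using transition_expectation_bounds[OF mp that, of 0 "indicator C" 1]
    by (auto simp: q_def indicator_def)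
  have q_le_e: "q t y \<le> e t" if "y \<in> C" "0 \<le> t" for t y
    unfolding e_def by (rule member_le_sum) (use C that q01 in auto)
  have bq: "bounded (q t ` S)" if "0 \<le> t" for t
    using q01 that by (intro boundedI[where B=1]) auto
  have step: "q (s + t) y \<le> q s y + M"
    if y: "y \<in> C" and st: "0 \<le> s" "0 \<le> t" and M: "0 \<le> M" "\<And>z. z \<in> C \<Longrightarrow> q t z \<le> M" for s t y M
  proof -
    have yS: "y \<in> S" using y C by auto
    interpret prob_space "P y" by (rule markov_process_prob_space[OF mp yS])
    have i1: "integrable (P y) (\<lambda>\<omega>. indicator C (X s \<omega>) :: real)"
      by (rule markov_process_integrable[OF mp yS st(1) bounded_indicator_image])
    have i2: "integrable (P y) (\<lambda>\<omega>. transition_expectation P X t (indicator C) (X s \<omega>))"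
      by (rule markov_process_integrable[OF mp yS st(1)
            bounded_transition_expectation[OF mp st(2) bounded_indicator_image]])
    have "q (s + t) y = 1 - transition_expectation P X s (transition_expectation P X t (indicator C)) y"
      unfolding q_def
      by (subst transition_semigroup[OF mp \<open>countable S\<close> yS st bounded_indicator_image]) simp
    also have "\<dots> = (\<integral>\<omega>. q t (X s \<omega>) \<partial>P y)"
      unfolding q_def transition_expectation_def[of P X s] using i2 by (simp add: prob_space)
    also have "\<dots> \<le> (\<integral>\<omega>. (1 - indicator C (X s \<omega>)) + M \<partial>P y)"
    proof (rule integral_mono)
      show "integrable (P y) (\<lambda>\<omega>. q t (X s \<omega>))"
        by (rule markov_process_integrable[OF mp yS st(1) bq[OF st(2)]])
      show "integrable (P y) (\<lambda>\<omega>. (1 - indicator C (X s \<omega>)) + M)" using i1 by simp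
      fix \<omega> assume "\<omega> \<in> space (P y)"
      then have "X s \<omega> \<in> S" using markov_process_in_space[OF mp yS st(1)] by blast
      then show "q t (X s \<omega>) \<le> (1 - indicator C (X s \<omega>)) + M"
        using q01(2)[of "X s \<omega>" t] M st by (auto simp: indicator_def)
    qed
    also have "\<dots> = q s y + M"
      unfolding q_def transition_expectation_def using i1 by (simp add: prob_space)
    finally show ?thesis .
  qed
  have e0: "0 \<le> e t" if "0 \<le> t" for t
    unfolding e_def using q01 C that by (intro sum_nonneg) auto
  have iter: "q (real k * t) y \<le> real k * e t" if "y \<in> C" "0 \<le> t" "k \<ge> 1" for k t y
    using \<open>k \<ge> 1\<close> \<open>y \<in> C\<close>
  proof (induction k arbitrary: y rule: nat_induct_at_least)
    case base then show ?case using q_le_e \<open>0 \<le> t\<close> by simp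
  next
    case (Suc k)
    have "q (t + real k * t) y \<le> q t y + real k * e t"
      using Suc \<open>0 \<le> t\<close> e0 by (intro step) auto
    then show ?case using q_le_e[OF Suc.prems \<open>0 \<le> t\<close>] by (simp add: algebra_simps)
  qed
  have "q t x \<le> 0"
  proof (cases "t = 0")
    case True
    have "AE \<omega> in P x. X 0 \<omega> = x" using mp x C by (auto simp: markov_process_def)
    moreover have xS: "x \<in> S" using x C by auto
    ultimately have "transition_expectation P X 0 (indicator C) x = (\<integral>\<omega>. 1 \<partial>P x)"
      unfolding transition_expectation_def
      by (intro integral_cong_AE markov_process_borel_measurable[OF mp]) (auto simp: x)
    then show ?thesis using prob_space.prob_space[OF markov_process_prob_space[OF mp xS]]
      by (simp add: q_def True)
  next
    case False
    then have t: "0 < t" using t by simp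
    have "((\<lambda>h. q h y / h) \<longlongrightarrow> 0) (at_right 0)" if "y \<in> C" for y
    proof -
      have "((\<lambda>h. (transition_expectation P X h (indicator C) y - indicator C y) / h)
              \<longlongrightarrow> L (indicator C) y) (at_right 0)"
        using gen that C bounded_indicator_image
        unfolding has_generator_def transition_expectation_def by blast
      from tendsto_minus[OF this] show ?thesis
        using that closed[OF that] by (simp add: q_def minus_divide_left)
    qed
    then have "((\<lambda>h. \<Sum>y\<in>C. q h y / h) \<longlongrightarrow> 0) (at_right 0)"
      by (rule tendsto_null_sum)
    then have "((\<lambda>h. e h / h) \<longlongrightarrow> 0) (at_right 0)"
      by (simp add: e_def sum_divide_distrib)
    moreover have "filterlim (\<lambda>k. t / real (Suc k)) (at_right 0) sequentially"
      using t LIMSEQ_Suc[OF lim_const_over_n[of t]] unfolding filterlim_at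
      by (auto intro!: always_eventually)
    ultimately have "(\<lambda>k. e (t / real (Suc k)) / (t / real (Suc k))) \<longlonglongrightarrow> 0"
      by (rule filterlim_compose)
    from tendsto_mult_right[OF this, of t]
    have "(\<lambda>k. t * (e (t / real (Suc k)) / (t / real (Suc k)))) \<longlonglongrightarrow> 0"
      by simp
    moreover have "q t x \<le> t * (e (t / real (Suc k)) / (t / real (Suc k)))" for k
    proof -
      have "real (Suc k) * (t / real (Suc k)) = t" by simp
      then have "q t x \<le> real (Suc k) * e (t / real (Suc k))"
        using iter[OF x, of "t / real (Suc k)" "Suc k"] t by simp
      also have "\<dots> = t * (e (t / real (Suc k)) / (t / real (Suc k)))"
        using t by simp
      finally show ?thesis .
    qed
    ultimately show ?thesis by (intro LIMSEQ_le_const[of _ 0]) blast+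
  qed
  moreover have "0 \<le> q t x" using q01 x C t by auto
  ultimately show ?thesis by (simp add: q_def)
qed

text \<open>
  By the Markov property the event of being inside \<open>C\<close> at time \<open>s\<close> and outside at time \<open>t\<close> has
  probability zero, whatever the starting point.
\<close>

lemma AE_stays_in_closed_set:
  assumes mp: "markov_process S P X" and cS: "countable S" and gen: "has_generator S P X L"
    and C: "finite C" "C \<subseteq> S" and closed: "\<And>y. y \<in> C \<Longrightarrow> L (indicator C) y = 0"
    and x: "x \<in> S" and st: "0 \<le> s" "s \<le> t"
  shows "AE \<omega> in P x. X s \<omega> \<in> C \<longrightarrow> X t \<omega> \<in> C"
proof -
  interpret prob_space "P x" by (rule markov_process_prob_space[OF mp x])
  let ?I = "indicator C :: _ \<Rightarrow> real" and ?J = "indicator (- C) :: _ \<Rightarrow> real"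
  have t: "0 \<le> t" and r: "0 \<le> t - s" using st by auto
  have J: "?J = (\<lambda>y. 1 - ?I y)" by (auto simp: indicator_def)
  have q: "transition_expectation P X (t - s) ?J y = 0" if "y \<in> C" for y
  proof -
    have yS: "y \<in> S" using C that by auto
    have "transition_expectation P X (t - s) ?J y = 1 - transition_expectation P X (t - s) ?I y"
      unfolding J transition_expectation_def
      using markov_process_integrable[OF mp yS r, of ?I] bounded_indicator_image
        prob_space.prob_space[OF markov_process_prob_space[OF mp yS]]
      by (subst Bochner_Integration.integral_diff)
        (auto simp: finite_measure.integrable_const
            prob_space.finite_measure[OF markov_process_prob_space[OF mp yS]])
    then show ?thesis
      using closed_set_never_left[OF mp cS gen C closed that r] by simp
  qed
  have "(\<integral>\<omega>. ?I (X s \<omega>) * ?J (X t \<omega>) \<partial>P x)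
      = (\<integral>\<omega>. ?I (X s \<omega>) * transition_expectation P X (t - s) ?J (X s \<omega>) \<partial>P x)"
    using markov_property_weighted[OF mp cS x st(1) r, of ?J ?I, OF bounded_indicator_image bounded_indicator_image] by simp
  also have "\<dots> = (\<integral>\<omega>. 0 \<partial>P x)"
    using q by (intro Bochner_Integration.integral_cong) (auto simp: indicator_def)
  finally have z: "(\<integral>\<omega>. ?I (X s \<omega>) * ?J (X t \<omega>) \<partial>P x) = 0" by simp
  have "integrable (P x) (\<lambda>\<omega>. ?I (X s \<omega>) * ?J (X t \<omega>))"
    by (intro integrable_const_bound[where B=1] borel_measurable_times
        markov_process_borel_measurable[OF mp x] st t) (auto simp: indicator_def)
  from integral_nonneg_eq_0_iff_AE[OF this] z
  have "AE \<omega> in P x. ?I (X s \<omega>) * ?J (X t \<omega>) = 0" by auto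
  then show ?thesis by eventually_elim (auto simp: indicator_def split: if_splits)
qed

section \<open>The generator as a sum over site maps\<close>

abbreviation swap :: "nat \<Rightarrow> nat \<Rightarrow> nat \<Rightarrow> nat" where
  "swap \<equiv> Transposition.transpose"

text \<open>
  All particles at \<open>a\<close> are transferred to \<open>b\<close>. For a bulk site \<open>a\<close> there is at most one, and if there
  is none then the configuration does not change; so the jump rate, proportional to the number of
  particles at \<open>a\<close>, can be replaced by a constant rate.
\<close>

definition absorb :: "nat \<Rightarrow> nat \<Rightarrow> config \<Rightarrow> config" where
  "absorb a b \<eta> = \<eta>(a := 0, b := \<eta> b + \<eta> a)"

text \<open>
  These finite sets are closed for the dynamics. They encode conservation of the number of particles
  together with monotonicity of the number of particles absorbed at \<open>N\<close>.
\<close>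

definition count_level :: "nat \<Rightarrow> nat \<Rightarrow> nat \<Rightarrow> config set" where
  "count_level N m c = {\<eta> \<in> dual_configs N. (\<Sum>z\<le>N. \<eta> z) = m \<and> c \<le> \<eta> N}"

lemma move_eq_transpose:
  assumes "x \<noteq> y" "\<eta> x = 1" "\<eta> y = 0"
  shows "move \<eta> x y = \<eta> \<circ> swap x y"
  using assms by (auto simp: move_def Transposition.transpose_def fun_eq_iff)

lemma comp_transpose_eq: "\<eta> x = \<eta> y \<Longrightarrow> \<eta> \<circ> swap x y = \<eta>"
  by (auto simp: Transposition.transpose_def fun_eq_iff)

text \<open>
  The stirring representation. An exclusion jump across an edge only happens between an occupied
  and an empty site, and then it interchanges their contents; if both sites have the same
  content, interchanging them changes nothing. Thus each edge contributes the interchange of its two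
  end points at the constant rate of the edge.
\<close>

lemma dual_generator_stirring:
  assumes E: "conductance_graph N E w" and N: "N \<ge> 2" and \<eta>: "\<eta> \<in> dual_configs N"
  shows "dual_generator N E w wL wR f \<eta> =
     (\<Sum>(x, y) \<in> {(x, y). x < y \<and> {x, y} \<in> E}. w x y * (f (\<eta> \<circ> swap x y) - f \<eta>))
     + wL * (f (absorb 1 0 \<eta>) - f \<eta>) + wR * (f (absorb (N - 1) N \<eta>) - f \<eta>)"
proof -
  have occ: "\<eta> x = 0 \<or> \<eta> x = 1" if "x \<in> {1..N-1}" for x
    using \<eta> that by (force simp: dual_configs_def le_Suc_eq)
  have bulk: "real (\<eta> x) * (1 - real (\<eta> y)) * (f (move \<eta> x y) - f \<eta>)
           + real (\<eta> y) * (1 - real (\<eta> x)) * (f (move \<eta> y x) - f \<eta>)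
         = f (\<eta> \<circ> swap x y) - f \<eta>" if "{x, y} \<in> E" for x y
  proof -
    have "x \<in> {1..N-1}" "y \<in> {1..N-1}" "x \<noteq> y"
      using E that by (fastforce simp: conductance_graph_def doubleton_eq_iff)+
    then show ?thesis
      using occ[of x] occ[of y] move_eq_transpose[of x y \<eta>] move_eq_transpose[of y x \<eta>]
        comp_transpose_eq[of \<eta> x y]
      by (auto simp: Transposition.transpose_commute)
  qed
  have side: "real (\<eta> a) * (f (move \<eta> a b) - f \<eta>) = f (absorb a b \<eta>) - f \<eta>"
    if "a \<in> {1..N-1}" "a \<noteq> b" for a b
  proof (cases "\<eta> a = 0")
    case True
    then have "absorb a b \<eta> = \<eta>" by (auto simp: absorb_def fun_eq_iff)
    then show ?thesis using True by simp
  next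
    case False
    then have "\<eta> a = 1" using occ[OF that(1)] by simp
    moreover from this have "move \<eta> a b = absorb a b \<eta>"
      using that by (auto simp: absorb_def move_def fun_eq_iff)
    ultimately show ?thesis by simp
  qed
  have "(\<Sum>(x, y) \<in> {(x, y). x < y \<and> {x, y} \<in> E}.
        w x y * (real (\<eta> x) * (1 - real (\<eta> y)) * (f (move \<eta> x y) - f \<eta>)
               + real (\<eta> y) * (1 - real (\<eta> x)) * (f (move \<eta> y x) - f \<eta>)))
      = (\<Sum>(x, y) \<in> {(x, y). x < y \<and> {x, y} \<in> E}. w x y * (f (\<eta> \<circ> swap x y) - f \<eta>))"
    by (rule sum.cong) (auto simp: bulk)
  then show ?thesis
    unfolding dual_generator_def using side[of 1 0] side[of "N - 1" N] N
    by (simp add: mult.assoc)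
qed

lemma finite_count_level: "finite (count_level N m c)"
proof (rule finite_subset)
  show "count_level N m c \<subseteq> {f. \<forall>x. (x \<in> {..N} \<longrightarrow> f x \<in> {..m}) \<and> (x \<notin> {..N} \<longrightarrow> f x = 0)}"
    by (auto simp: count_level_def dual_configs_def intro: member_le_sum)
  show "finite {f. \<forall>x. (x \<in> {..N} \<longrightarrow> f x \<in> {..m}) \<and> (x \<notin> {..N} \<longrightarrow> f x = (0::nat))}"
    by (rule finite_set_of_finite_funs) auto
qed

lemma countable_dual_configs: "countable (dual_configs N)"
proof -
  have "dual_configs N = (\<Union>m. count_level N m 0)" by (auto simp: count_level_def)
  then show ?thesis by (simp add: countable_finite finite_count_level)
qed

lemma comp_transpose_count_level:
  assumes "x \<in> {1..N-1}" "y \<in> {1..N-1}" "\<eta> \<in> count_level N m c"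
  shows "\<eta> \<circ> swap x y \<in> count_level N m c"
proof -
  have "(\<Sum>z\<le>N. (\<eta> \<circ> swap x y) z) = (\<Sum>z\<le>N. \<eta> z)"
    using assms by (intro sum.permute[symmetric] permutes_swap_id) auto
  then show ?thesis
    using assms by (auto simp: count_level_def dual_configs_def Transposition.transpose_def)
qed

lemma absorb_count_level:
  assumes "a \<in> {1..N-1}" "b \<in> {0, N}" "\<eta> \<in> count_level N m c"
  shows "absorb a b \<eta> \<in> count_level N m c"
proof -
  have ab: "a \<in> {..N}" "b \<in> {..N} - {a}" using assms by auto
  have "(\<Sum>z\<le>N. g z) = g a + (g b + (\<Sum>z\<in>{..N} - {a} - {b}. g z))" for g :: "nat \<Rightarrow> nat"
    using ab by (simp only: sum.remove[of "{..N}" a] sum.remove[of "{..N} - {a}" b] finite_Diff finite_atMost)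
  note this[of "absorb a b \<eta>"] this[of \<eta>]
  moreover have "(\<Sum>z\<in>{..N} - {a} - {b}. absorb a b \<eta> z) = (\<Sum>z\<in>{..N} - {a} - {b}. \<eta> z)"
    by (rule sum.cong) (auto simp: absorb_def)
  ultimately have "(\<Sum>z\<le>N. absorb a b \<eta> z) = (\<Sum>z\<le>N. \<eta> z)"
    using ab by (simp add: absorb_def)
  then show ?thesis
    using assms by (auto simp: count_level_def dual_configs_def absorb_def)
qed

section \<open>Limits of right-continuous integer-valued paths\<close>

lemma obtain_rational_with_same_value:
  fixes u :: "real \<Rightarrow> 'a"
  assumes "\<forall>\<^sub>F s in at_right t. u s = u t"
  obtains q :: rat where "t < real_of_rat q" "u (real_of_rat q) = u t"
proof -
  obtain b where b: "t < b" "\<forall>s>t. s < b \<longrightarrow> u s = u t"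
    using assms unfolding eventually_at_right_field by blast
  obtain q where "t < real_of_rat q" "real_of_rat q < b" using of_rat_dense[OF b(1)] by blast
  then show ?thesis using b that by blast
qed

text \<open>
  Expresses a statement about the limit through countably many coordinates, which makes it
  measurable. The second disjunct gives the default value that \<open>Lim\<close> takes on a divergent path. Such paths
  will form a null set, but on a measure space that may be incomplete the event has to be measurable
  exactly, and not only up to a null set.
\<close>

lemma Lim_nat_eq_iff:
  fixes u :: "real \<Rightarrow> nat"
  assumes rc: "\<And>t. 0 \<le> t \<Longrightarrow> \<forall>\<^sub>F s in at_right t. u s = u t"
  defines "settles \<equiv> \<lambda>a. \<exists>T::nat. \<forall>q::rat. real T \<le> real_of_rat q \<longrightarrow> u (real_of_rat q) = a"
  shows "Lim at_top u = k \<longleftrightarrow>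
    settles k \<or> (\<forall>a. \<not> settles a) \<and> (THE a::nat. False) = k"
proof -
  have conv: "(u \<longlongrightarrow> a) at_top \<longleftrightarrow> settles a" for a
    unfolding tendsto_discrete
  proof
    assume "\<forall>\<^sub>F t in at_top. u t = a"
    then obtain T where T: "\<And>t. T \<le> t \<Longrightarrow> u t = a" by (auto simp: eventually_at_top_linorder)
    obtain n where n: "T \<le> real n" using real_arch_simple by blast
    show "settles a" unfolding settles_def
      by (intro exI[of _ n] allI impI T order_trans[OF n])
  next
    assume "settles a"
    then obtain T :: nat where T: "\<And>q::rat. real T \<le> real_of_rat q \<Longrightarrow> u (real_of_rat q) = a"
      by (auto simp: settles_def)
    have "u t = a" if "real T \<le> t" for t
    proof -
      have "0 \<le> t" using that by (rule order_trans[OF of_nat_0_le_iff])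
      from obtain_rational_with_same_value[OF rc[OF this]]
      obtain q where "t < real_of_rat q" "u (real_of_rat q) = u t" .
      then show ?thesis using T[of q] that by simp
    qed
    then show "\<forall>\<^sub>F t in at_top. u t = a" by (auto simp: eventually_at_top_linorder)
  qed
  show ?thesis
  proof (cases "\<exists>a. settles a")
    case True
    then obtain a where a: "settles a" by blast
    then have "Lim at_top u = a" using conv tendsto_Lim trivial_limit_at_top_linorder by blast
    moreover have "b = a" if "settles b" for b
      using a that conv tendsto_unique trivial_limit_at_top_linorder by blast
    ultimately show ?thesis using a by blast
  next
    case False
    then have "(\<lambda>l. (u \<longlongrightarrow> l) at_top) = (\<lambda>_. False)" using conv by blast
    then show ?thesis using False by (simp add: t2_space_class.Lim_def)
  qed
qed

lemma eventually_const_if_mono_on_rationals: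
  fixes u :: "real \<Rightarrow> nat"
  assumes rc: "\<And>t. 0 \<le> t \<Longrightarrow> \<forall>\<^sub>F s in at_right t. u s = u t"
    and mono: "\<And>p q::rat. 0 \<le> p \<Longrightarrow> p \<le> q \<Longrightarrow> u (real_of_rat p) \<le> u (real_of_rat q)"
    and bound: "\<And>q::rat. 0 \<le> q \<Longrightarrow> u (real_of_rat q) \<le> m"
  shows "\<exists>a. \<forall>\<^sub>F t in at_top. u t = a"
proof -
  define V where "V = (\<lambda>q::rat. u (real_of_rat q)) ` {0..}"
  have V: "finite V" "V \<noteq> {}"
    using bound by (auto simp: V_def intro!: finite_subset[of _ "{..m}"])
  then obtain p where p: "0 \<le> p" "Max V = u (real_of_rat p)"
    using Max_in[OF V] unfolding V_def by (metis (no_types, lifting) atLeast_iff imageE)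
  have at_rat: "u (real_of_rat q) = Max V" if "p \<le> q" for q
    using mono[OF p(1) that] p Max_ge[OF V(1), of "u (real_of_rat q)"] that by (force simp: V_def)
  have "u t = Max V" if t: "real_of_rat p \<le> t" for t
  proof -
    have "0 \<le> t" using t p(1) order_trans[of 0 "real_of_rat p" t] by simp
    from obtain_rational_with_same_value[OF rc[OF this]]
    obtain q where q: "t < real_of_rat q" "u (real_of_rat q) = u t" .
    then have "p \<le> q" using t le_less_trans[of "real_of_rat p" t "real_of_rat q"] by (simp add: of_rat_less)
    then show ?thesis using q at_rat[of q] by simp
  qed
  then show ?thesis by (auto simp: eventually_at_top_linorder)
qed

section \<open>Absorption probabilities are harmonic\<close>

locale boundary_driven_exclusion =
  fixes N :: nat and E :: "nat set set" and w :: "nat \<Rightarrow> nat \<Rightarrow> real" and wL wR :: real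
    and P :: "config \<Rightarrow> 'w measure" and \<xi> :: "real \<Rightarrow> 'w \<Rightarrow> config"
  assumes N: "N \<ge> 2" and graph: "conductance_graph N E w"
    and wL: "wL > 0" and wR: "wR > 0"
    and process: "dual_exclusion_process N E w wL wR P \<xi>"
begin

lemma markov: "markov_process (dual_configs N) P \<xi>"
  and generator: "has_generator (dual_configs N) P \<xi> (dual_generator N E w wL wR)"
  using process by (auto simp: dual_exclusion_process_def)

lemma edge_bulk:
  assumes "{x, y} \<in> E" shows "x \<in> {1..N-1}" "y \<in> {1..N-1}" "x \<noteq> y"
  using graph assms by (fastforce simp: conductance_graph_def doubleton_eq_iff)+

lemma generator_zero_if_closed:
  assumes "\<eta> \<in> dual_configs N" "\<eta> \<in> C"
    and "\<And>x y. x \<in> {1..N-1} \<Longrightarrow> y \<in> {1..N-1} \<Longrightarrow> \<eta> \<circ> swap x y \<in> C"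
    and "absorb 1 0 \<eta> \<in> C" "absorb (N - 1) N \<eta> \<in> C"
  shows "dual_generator N E w wL wR (indicator C) \<eta> = 0"
proof -
  have "(\<Sum>(x, y) \<in> {(x, y). x < y \<and> {x, y} \<in> E}.
      w x y * (indicator C (\<eta> \<circ> swap x y) - indicator C \<eta>)) = (0::real)"
    using assms edge_bulk by (intro sum.neutral) (auto simp: indicator_def)
  then show ?thesis
    using assms by (simp add: dual_generator_stirring[OF graph N])
qed

lemma AE_stays_in_count_level:
  assumes "\<eta> \<in> dual_configs N" "0 \<le> s" "s \<le> t"
  shows "AE \<omega> in P \<eta>. \<xi> s \<omega> \<in> count_level N m c \<longrightarrow> \<xi> t \<omega> \<in> count_level N m c"
proof (rule AE_stays_in_closed_set[OF markov countable_dual_configs generator finite_count_level _ _ assms])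
  show "count_level N m c \<subseteq> dual_configs N" by (auto simp: count_level_def)
  fix \<zeta> assume \<zeta>: "\<zeta> \<in> count_level N m c"
  then show "dual_generator N E w wL wR (indicator (count_level N m c)) \<zeta> = 0"
    using N by (intro generator_zero_if_closed comp_transpose_count_level absorb_count_level)
      (auto simp: count_level_def)
qed

lemma AE_start: "\<eta> \<in> dual_configs N \<Longrightarrow> AE \<omega> in P \<eta>. \<xi> 0 \<omega> = \<eta>"
  using markov by (simp add: markov_process_def)

text \<open>
  The number of particles at \<open>N\<close> never decreases and is bounded by the total number of particles,
  so it is eventually constant. The closed sets give this along rational times outside one null
  set; right-continuity extends it to all times.
\<close>

lemma AE_eventually_absorbed_count_const:
  assumes \<eta>: "\<eta> \<in> dual_configs N"
  shows "AE \<omega> in P \<eta>. \<exists>a. \<forall>\<^sub>F t in at_top. \<xi> t \<omega> N = a"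
proof -
  define m where "m = (\<Sum>z\<le>N. \<eta> z)"
  have "AE \<omega> in P \<eta>. \<forall>q::rat. 0 \<le> q \<longrightarrow> \<xi> (real_of_rat q) \<omega> \<in> count_level N m 0"
    unfolding AE_all_countable
  proof
    fix q :: rat
    show "AE \<omega> in P \<eta>. 0 \<le> q \<longrightarrow> \<xi> (real_of_rat q) \<omega> \<in> count_level N m 0"
    proof (cases "0 \<le> q")
      case True
      then have "AE \<omega> in P \<eta>. \<xi> 0 \<omega> \<in> count_level N m 0 \<longrightarrow> \<xi> (real_of_rat q) \<omega> \<in> count_level N m 0"
        by (intro AE_stays_in_count_level \<eta>) auto
      with AE_start[OF \<eta>] show ?thesis
        by eventually_elim (use \<eta> in \<open>auto simp: count_level_def m_def\<close>)
    qed simp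
  qed
  moreover have "AE \<omega> in P \<eta>. \<forall>p q::rat. \<forall>c::nat. 0 \<le> p \<longrightarrow> p \<le> q \<longrightarrow>
      \<xi> (real_of_rat p) \<omega> \<in> count_level N m c \<longrightarrow> \<xi> (real_of_rat q) \<omega> \<in> count_level N m c"
    unfolding AE_all_countable
  proof (intro allI)
    fix p q :: rat and c :: nat
    show "AE \<omega> in P \<eta>. 0 \<le> p \<longrightarrow> p \<le> q \<longrightarrow>
      \<xi> (real_of_rat p) \<omega> \<in> count_level N m c \<longrightarrow> \<xi> (real_of_rat q) \<omega> \<in> count_level N m c"
    proof (cases "0 \<le> p \<and> p \<le> q")
      case True
      then show ?thesis
        using AE_stays_in_count_level[OF \<eta>, of "real_of_rat p" "real_of_rat q"]
        by (simp add: of_rat_less_eq)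
    qed auto
  qed
  moreover have "AE \<omega> in P \<eta>. \<forall>t\<ge>0. \<forall>\<^sub>F s in at_right t. \<xi> s \<omega> = \<xi> t \<omega>"
    using markov \<eta> by (intro AE_I2) (auto simp: markov_process_def)
  ultimately show ?thesis
  proof eventually_elim
    case (elim \<omega>)
    show ?case
    proof (rule eventually_const_if_mono_on_rationals[where m=m])
      fix t :: real assume "0 \<le> t"
      then have "\<forall>\<^sub>F s in at_right t. \<xi> s \<omega> = \<xi> t \<omega>" using elim(3) by blast
      then show "\<forall>\<^sub>F s in at_right t. \<xi> s \<omega> N = \<xi> t \<omega> N" by eventually_elim simp
    next
      fix p q :: rat assume pq: "0 \<le> p" "p \<le> q"
      then have "\<xi> (real_of_rat p) \<omega> \<in> count_level N m (\<xi> (real_of_rat p) \<omega> N)"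
        using elim(1) by (auto simp: count_level_def)
      then have "\<xi> (real_of_rat q) \<omega> \<in> count_level N m (\<xi> (real_of_rat p) \<omega> N)"
        using elim(2) pq by blast
      then show "\<xi> (real_of_rat p) \<omega> N \<le> \<xi> (real_of_rat q) \<omega> N" by (simp add: count_level_def)
    next
      fix q :: rat assume "0 \<le> q"
      then have "\<xi> (real_of_rat q) \<omega> \<in> count_level N m 0" using elim(1) by blast
      then show "\<xi> (real_of_rat q) \<omega> N \<le> m"
        by (auto simp: count_level_def intro!: member_le_sum)
    qed
  qed
qed

definition absorption_prob :: "nat \<Rightarrow> config \<Rightarrow> real" where
  "absorption_prob k \<eta> = \<P>(\<omega> in P \<eta>. limit_config \<xi> \<omega> N = k)"

lemma limit_count_sets:
  assumes \<eta>: "\<eta> \<in> dual_configs N"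
  shows "{\<omega> \<in> space (P \<eta>). limit_config \<xi> \<omega> N = k} \<in> sets (P \<eta>)"
proof -
  define c where "c a \<omega> \<longleftrightarrow> (\<exists>T::nat. \<forall>q::rat. real T \<le> real_of_rat q \<longrightarrow> \<xi> (real_of_rat q) \<omega> N = a)" for a \<omega>
  have "Measurable.pred (P \<eta>) (\<lambda>\<omega>. real T \<le> real_of_rat q \<longrightarrow> \<xi> (real_of_rat q) \<omega> N = a)"
    for T :: nat and q :: rat and a
  proof (cases "real T \<le> real_of_rat q")
    case True
    then have "0 \<le> real_of_rat q" by (rule order_trans[OF of_nat_0_le_iff])
    from markov_process_measurable[OF markov \<eta> this]
    have "Measurable.pred (P \<eta>) (\<lambda>\<omega>. \<xi> (real_of_rat q) \<omega> N = a)"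
      by (rule measurable_compose) simp
    then show ?thesis using True by simp
  qed simp
  then have c: "Measurable.pred (P \<eta>) (c a)" for a
    unfolding c_def[abs_def] by (intro pred_intros_countable)
  have "limit_config \<xi> \<omega> N = k \<longleftrightarrow> c k \<omega> \<or> (\<forall>a. \<not> c a \<omega>) \<and> (THE a::nat. False) = k"
    if "\<omega> \<in> space (P \<eta>)" for \<omega>
    unfolding limit_config_def c_def
  proof (rule Lim_nat_eq_iff)
    fix t :: real assume "0 \<le> t"
    then have "\<forall>\<^sub>F s in at_right t. \<xi> s \<omega> = \<xi> t \<omega>"
      using markov \<eta> that by (auto simp: markov_process_def)
    then show "\<forall>\<^sub>F s in at_right t. \<xi> s \<omega> N = \<xi> t \<omega> N" by eventually_elim simp
  qed
  then have "{\<omega> \<in> space (P \<eta>). limit_config \<xi> \<omega> N = k}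
      = {\<omega> \<in> space (P \<eta>). c k \<omega> \<or> (\<forall>a. \<not> c a \<omega>) \<and> (THE a::nat. False) = k}"
    by blast
  also have "\<dots> \<in> sets (P \<eta>)"
    using c by measurable
  finally show ?thesis .
qed

text \<open>
  Since the number of particles at \<open>N\<close> is almost surely eventually constant, the law of its limit is the
  limit of its laws at fixed times, by dominated convergence. This reduces a functional of the
  whole path to functionals of a single time, to which the Markov property applies directly.
\<close>

lemma transition_tendsto_absorption_prob:
  assumes \<eta>: "\<eta> \<in> dual_configs N" and T: "filterlim T at_top sequentially" "\<And>j::nat. 0 \<le> T j"
  shows "(\<lambda>j. transition_expectation P \<xi> (T j) (\<lambda>\<zeta>. indicator {k} (\<zeta> N)) \<eta>)
           \<longlonglongrightarrow> absorption_prob k \<eta>"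
proof -
  interpret prob_space "P \<eta>" by (rule markov_process_prob_space[OF markov \<eta>])
  let ?A = "{\<omega> \<in> space (P \<eta>). limit_config \<xi> \<omega> N = k}"
  have A: "?A \<in> sets (P \<eta>)" by (rule limit_count_sets[OF \<eta>])
  have "(\<lambda>j. (\<integral>\<omega>. indicator {k} (\<xi> (T j) \<omega> N) \<partial>P \<eta>)) \<longlonglongrightarrow> (\<integral>\<omega>. indicator ?A \<omega> \<partial>P \<eta> :: real)"
  proof (rule integral_dominated_convergence[where w="\<lambda>_. 1"])
    show "(\<lambda>\<omega>. indicator {k} (\<xi> (T j) \<omega> N) :: real) \<in> borel_measurable (P \<eta>)" for j
      by (rule markov_process_borel_measurable[OF markov \<eta> T(2)])
    show "AE \<omega> in P \<eta>. (\<lambda>j. indicator {k} (\<xi> (T j) \<omega> N) :: real) \<longlonglongrightarrow> indicator ?A \<omega>"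
      using AE_eventually_absorbed_count_const[OF \<eta>] AE_space
    proof eventually_elim
      case (elim \<omega>)
      then obtain a where a: "\<forall>\<^sub>F t in at_top. \<xi> t \<omega> N = a" by blast
      then have "((\<lambda>t. \<xi> t \<omega> N) \<longlongrightarrow> a) at_top" by (simp add: tendsto_discrete)
      then have "limit_config \<xi> \<omega> N = a"
        unfolding limit_config_def by (intro tendsto_Lim) auto
      then have "indicator ?A \<omega> = (indicator {k} a :: real)"
        using elim by (auto simp: indicator_def)
      moreover have "\<forall>\<^sub>F j in sequentially. \<xi> (T j) \<omega> N = a"
        using a T(1) by (rule eventually_compose_filterlim)
      then have "\<forall>\<^sub>F j in sequentially. indicator {k} (\<xi> (T j) \<omega> N) = (indicator {k} a :: real)"
        by eventually_elim simp
      ultimately show ?case by (simp add: tendsto_eventually)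
    qed
  qed (use A in \<open>auto simp: indicator_def\<close>)
  moreover have "(\<integral>\<omega>. indicator ?A \<omega> \<partial>P \<eta>) = absorption_prob k \<eta>"
    using A by (simp add: absorption_prob_def)
  ultimately show ?thesis by (simp add: transition_expectation_def)
qed

lemma absorption_prob_bounds: "\<eta> \<in> dual_configs N \<Longrightarrow> 0 \<le> absorption_prob k \<eta> \<and> absorption_prob k \<eta> \<le> 1"
  unfolding absorption_prob_def
  using prob_space.prob_le_1[OF markov_process_prob_space[OF markov]] by simp

lemma bounded_absorption_prob: "bounded (absorption_prob k ` dual_configs N)"
  using absorption_prob_bounds by (intro boundedI[where B=1]) fastforce

text \<open>
  Both sides are the limit, as \<open>j\<close> tends to infinity, of the probability of having \<open>k\<close> particles at \<open>N\<close> at time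
  \<open>s + j\<close>.
\<close>

lemma absorption_prob_invariant:
  assumes \<eta>: "\<eta> \<in> dual_configs N" and s: "0 \<le> s"
  shows "transition_expectation P \<xi> s (absorption_prob k) \<eta> = absorption_prob k \<eta>"
proof -
  interpret prob_space "P \<eta>" by (rule markov_process_prob_space[OF markov \<eta>])
  let ?f = "\<lambda>\<zeta>::config. indicator {k} (\<zeta> N) :: real"
  have bf: "bounded (?f ` dual_configs N)"
    by (intro boundedI[where B=1]) (auto simp: indicator_def)
  have "filterlim (\<lambda>j. s + real j) at_top sequentially"
    by (rule filterlim_tendsto_add_at_top[OF tendsto_const filterlim_real_sequentially])
  then have "(\<lambda>j. transition_expectation P \<xi> (s + real j) ?f \<eta>) \<longlonglongrightarrow> absorption_prob k \<eta>"
    using s by (intro transition_tendsto_absorption_prob \<eta>) auto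
  moreover have "(\<lambda>j. transition_expectation P \<xi> s (transition_expectation P \<xi> (real j) ?f) \<eta>)
      \<longlonglongrightarrow> transition_expectation P \<xi> s (absorption_prob k) \<eta>"
    unfolding transition_expectation_def[of P \<xi> s]
  proof (rule integral_dominated_convergence[where w="\<lambda>_. 1"])
    show "AE \<omega> in P \<eta>. (\<lambda>j. transition_expectation P \<xi> (real j) ?f (\<xi> s \<omega>))
        \<longlonglongrightarrow> absorption_prob k (\<xi> s \<omega>)"
      using markov_process_in_space[OF markov \<eta> s] filterlim_real_sequentially
      by (intro AE_I2 transition_tendsto_absorption_prob) auto
    show "AE \<omega> in P \<eta>. norm (transition_expectation P \<xi> (real j) ?f (\<xi> s \<omega>)) \<le> 1" for j
    proof (intro AE_I2)
      fix \<omega> assume "\<omega> \<in> space (P \<eta>)"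
      then have "\<xi> s \<omega> \<in> dual_configs N" using markov_process_in_space[OF markov \<eta> s] by blast
      from transition_expectation_bounds[OF markov this, of "real j" 0 ?f 1]
      show "norm (transition_expectation P \<xi> (real j) ?f (\<xi> s \<omega>)) \<le> 1"
        by (auto simp: indicator_def)
    qed
  qed (auto intro: markov_process_borel_measurable[OF markov \<eta> s])
  moreover have "transition_expectation P \<xi> (s + real j) ?f \<eta>
      = transition_expectation P \<xi> s (transition_expectation P \<xi> (real j) ?f) \<eta>" for j
    by (rule transition_semigroup[OF markov countable_dual_configs \<eta> s _ bf]) simp
  ultimately show ?thesis using LIMSEQ_unique by auto
qed

text \<open>
  The difference quotients whose limit defines the generator vanish identically, by invariance.
\<close>

lemma absorption_prob_harmonic:
  assumes \<eta>: "\<eta> \<in> dual_configs N"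
  shows "dual_generator N E w wL wR (absorption_prob k) \<eta> = 0"
proof -
  have "((\<lambda>t. (transition_expectation P \<xi> t (absorption_prob k) \<eta> - absorption_prob k \<eta>) / t)
      \<longlongrightarrow> dual_generator N E w wL wR (absorption_prob k) \<eta>) (at_right 0)"
    using generator \<eta> bounded_absorption_prob
    unfolding has_generator_def transition_expectation_def by blast
  moreover have "\<forall>\<^sub>F t in at_right 0.
      (transition_expectation P \<xi> t (absorption_prob k) \<eta> - absorption_prob k \<eta>) / t = 0"
    using eventually_at_right_less by eventually_elim (simp add: absorption_prob_invariant[OF \<eta>])
  then have "((\<lambda>t. (transition_expectation P \<xi> t (absorption_prob k) \<eta> - absorption_prob k \<eta>) / t)
      \<longlongrightarrow> 0) (at_right 0)"
    by (rule tendsto_eventually)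
  ultimately show ?thesis
    by (rule tendsto_unique[OF trivial_limit_at_right_real])
qed

lemma absorption_prob_absorbed:
  assumes \<eta>: "\<eta> \<in> dual_configs N" and empty: "\<And>x. x \<in> {1..N-1} \<Longrightarrow> \<eta> x = 0"
  shows "absorption_prob k \<eta> = indicator {k} (\<eta> N)"
proof -
  interpret prob_space "P \<eta>" by (rule markov_process_prob_space[OF markov \<eta>])
  have still: "AE \<omega> in P \<eta>. \<xi> t \<omega> = \<eta>" if t: "0 \<le> t" for t
  proof -
    have "AE \<omega> in P \<eta>. \<xi> 0 \<omega> \<in> {\<eta>} \<longrightarrow> \<xi> t \<omega> \<in> {\<eta>}"
    proof (rule AE_stays_in_closed_set[OF markov countable_dual_configs generator _ _ _ \<eta> order_refl t])
      fix \<zeta> assume "\<zeta> \<in> {\<eta>}"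
      then have [simp]: "\<zeta> = \<eta>" by simp
      have "absorb a b \<eta> = \<eta>" if "a \<in> {1..N-1}" for a b
        using empty[OF that] by (auto simp: absorb_def fun_eq_iff)
      then show "dual_generator N E w wL wR (indicator {\<eta>}) \<zeta> = 0"
        using N \<eta> empty by (auto intro!: generator_zero_if_closed comp_transpose_eq)
    qed (use \<eta> in auto)
    with AE_start[OF \<eta>] show ?thesis by eventually_elim simp
  qed
  have "transition_expectation P \<xi> (real j) (\<lambda>\<zeta>. indicator {k} (\<zeta> N)) \<eta> = indicator {k} (\<eta> N)" for j
  proof -
    have "transition_expectation P \<xi> (real j) (\<lambda>\<zeta>. indicator {k} (\<zeta> N)) \<eta>
        = (\<integral>\<omega>. indicator {k} (\<eta> N) \<partial>P \<eta>)"
      unfolding transition_expectation_def using still[of "real j"]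
      by (intro integral_cong_AE markov_process_borel_measurable[OF markov \<eta>]) auto
    then show ?thesis by (simp add: prob_space)
  qed
  moreover have "(\<lambda>j. transition_expectation P \<xi> (real j) (\<lambda>\<zeta>. indicator {k} (\<zeta> N)) \<eta>)
      \<longlonglongrightarrow> absorption_prob k \<eta>"
    by (rule transition_tendsto_absorption_prob[OF \<eta> filterlim_real_sequentially]) simp
  ultimately show ?thesis by (simp add: LIMSEQ_const_iff)
qed

end

section \<open>Labelled particles\<close>

text \<open>
  A particle with label \<open>i\<close> sits at \<open>X i\<close>. Labels make it possible to speak of the same
  sub-family of particles before and after a jump.
\<close>

definition occupation :: "('i \<Rightarrow> nat) \<Rightarrow> 'i set \<Rightarrow> config" where
  "occupation X A = (\<lambda>z. card {i \<in> A. X i = z})"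

text \<open>
  Labels outside \<open>A\<close> are parked at site \<open>0\<close>, which all the site maps below fix; so the set
  is invariant under these maps, and it is finite for finite \<open>A\<close>.
\<close>

definition labelled_configs :: "nat \<Rightarrow> 'i set \<Rightarrow> ('i \<Rightarrow> nat) set" where
  "labelled_configs N A = {X. (\<forall>i. (i \<in> A \<longrightarrow> X i \<in> {..N}) \<and> (i \<notin> A \<longrightarrow> X i = 0)) \<and>
     (\<forall>i\<in>A. \<forall>j\<in>A. X i = X j \<longrightarrow> X i \<in> {1..N-1} \<longrightarrow> i = j)}"

definition bulk_labels :: "nat \<Rightarrow> 'i set \<Rightarrow> ('i \<Rightarrow> nat) \<Rightarrow> 'i set" where
  "bulk_labels N A X = {i \<in> A. X i \<in> {1..N-1}}"

text \<open>
  Moving the labelled particles by a site map moves the configuration of every sub-family of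
  labels in the same way. This is the consistency of the process: the evolution of a sub-family does not
  depend on the other particles.
\<close>

lemma occupation_swap: "occupation (swap x y \<circ> X) A = occupation X A \<circ> swap x y"
proof
  fix z
  have "{i \<in> A. swap x y (X i) = z} = {i \<in> A. X i = swap x y z}"
    by (auto simp: Transposition.transpose_def)
  then show "occupation (swap x y \<circ> X) A z = (occupation X A \<circ> swap x y) z"
    by (simp add: occupation_def)
qed

lemma occupation_absorb:
  assumes "finite A" "a \<noteq> b"
  shows "occupation (id(a := b) \<circ> X) A = absorb a b (occupation X A)"
proof
  fix z
  have "{i \<in> A. (id(a := b)) (X i) = z} =
      (if z = a then {} else if z = b then {i \<in> A. X i = b} \<union> {i \<in> A. X i = a} else {i \<in> A. X i = z})"
    using assms by auto
  moreover have "card ({i \<in> A. X i = b} \<union> {i \<in> A. X i = a}) = card {i \<in> A. X i = b} + card {i \<in> A. X i = a}"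
    using assms by (intro card_Un_disjoint) auto
  ultimately show "occupation (id(a := b) \<circ> X) A z = absorb a b (occupation X A) z"
    using assms by (auto simp: occupation_def absorb_def)
qed

lemma labelled_configs_exclusion:
  assumes "X \<in> labelled_configs N A" "i \<in> A" "j \<in> A" "X i = X j" "X i \<in> {1..N-1}"
  shows "i = j"
  using assms unfolding labelled_configs_def mem_Collect_eq by metis

lemma occupation_in_dual_configs:
  assumes "finite A" "X \<in> labelled_configs N A" "I \<subseteq> A"
  shows "occupation X I \<in> dual_configs N"
proof -
  have "finite I" using assms finite_subset by blast
  have "card {i \<in> I. X i = z} \<le> 1" if z: "z \<in> {1..N-1}" for z
  proof -
    have "\<forall>i\<in>{i \<in> I. X i = z}. \<forall>j\<in>{i \<in> I. X i = z}. i = j"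
      using assms(3) z by (auto intro!: labelled_configs_exclusion[OF assms(2)])
    then show ?thesis using \<open>finite I\<close> by (simp add: card_le_Suc0_iff_eq)
  qed
  moreover have "card {i \<in> I. X i = z} = 0" if "z > N" for z
  proof -
    have "{i \<in> I. X i = z} = {}" using assms that by (fastforce simp: labelled_configs_def)
    then show ?thesis by (simp only: card.empty)
  qed
  ultimately show ?thesis by (auto simp: dual_configs_def occupation_def)
qed

lemma finite_labelled_configs: "finite A \<Longrightarrow> finite (labelled_configs N A)"
  by (rule finite_subset[OF _ finite_set_of_finite_funs[of A "{..N}" 0]])
    (auto simp: labelled_configs_def)

lemma swap_labelled_configs:
  assumes "x \<in> {1..N-1}" "y \<in> {1..N-1}" "X \<in> labelled_configs N A"
  shows "swap x y \<circ> X \<in> labelled_configs N A"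
proof -
  have "i = j" if ij: "i \<in> A" "j \<in> A" "swap x y (X i) = swap x y (X j)" "swap x y (X i) \<in> {1..N-1}" for i j
  proof -
    have "X i = X j" using ij(3) by (metis Transposition.transpose_involutory)
    moreover have "X i \<in> {1..N-1}" using ij(4) assms by (auto simp: Transposition.transpose_def split: if_splits)
    ultimately show ?thesis using ij assms by (auto simp: labelled_configs_def)
  qed
  moreover have "swap x y z \<le> N" if "z \<le> N" for z
    using that assms by (auto simp: Transposition.transpose_def)
  moreover have "swap x y 0 = 0" using assms by (auto simp: Transposition.transpose_def)
  ultimately show ?thesis using assms(3) unfolding labelled_configs_def by auto
qed

lemma absorb_labelled_configs:
  assumes "a \<in> {1..N-1}" "b \<in> {0, N}" "X \<in> labelled_configs N A"
  shows "id(a := b) \<circ> X \<in> labelled_configs N A"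
  using assms by (auto simp: labelled_configs_def)

lemma bulk_labels_swap:
  assumes "x \<in> {1..N-1}" "y \<in> {1..N-1}"
  shows "bulk_labels N A (swap x y \<circ> X) = bulk_labels N A X"
  using assms by (auto simp: bulk_labels_def Transposition.transpose_def)

section \<open>An alternating binomial sum over subsets\<close>

lemma sum_Pow_by_card:
  fixes f :: "'i set \<Rightarrow> real"
  assumes "finite A"
  shows "(\<Sum>I\<in>Pow A. f I) = (\<Sum>k\<le>card A. \<Sum>I | I \<subseteq> A \<and> card I = k. f I)"
proof -
  have "card ` Pow A \<subseteq> {..card A}" using assms by (auto intro: card_mono)
  then show ?thesis
    using sum.group[of "Pow A" "{..card A}" card f] assms by simp
qed

text \<open>
  Grouping the subsets of a set with \<open>b\<close> elements by their size \<open>k\<close>, the identity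
  \<open>(b choose k) * (k choose l) = (b choose l) * ((b - l) choose (k - l))\<close> leaves the binomial expansion
  of \<open>(1 - 1) ^ (b - l)\<close>.
\<close>

lemma binomial_inversion_Pow:
  assumes B: "finite B"
  shows "(\<Sum>I\<in>Pow B. (-1) ^ (card I - l) * real (card I choose l)) = of_bool (card B = l)"
proof -
  define b where "b = card B"
  have "(\<Sum>I\<in>Pow B. (-1) ^ (card I - l) * real (card I choose l))
      = (\<Sum>k\<le>b. real (b choose k) * ((-1) ^ (k - l) * real (k choose l)))"
    unfolding sum_Pow_by_card[OF B] b_def
  proof (rule sum.cong)
    fix k
    have "(\<Sum>I | I \<subseteq> B \<and> card I = k. (-1) ^ (card I - l) * real (card I choose l))
        = (\<Sum>I | I \<subseteq> B \<and> card I = k. (-1) ^ (k - l) * real (k choose l))"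
      by (rule sum.cong) auto
    then show "(\<Sum>I | I \<subseteq> B \<and> card I = k. (-1) ^ (card I - l) * real (card I choose l))
        = real (card B choose k) * ((-1) ^ (k - l) * real (k choose l))"
      using n_subsets[OF B, of k] by simp
  qed simp
  also have "\<dots> = of_bool (b = l)"
  proof (cases "l \<le> b")
    case False
    then show ?thesis by (auto intro!: sum.neutral simp: binomial_eq_0)
  next
    case True
    have "(\<Sum>k\<le>b. real (b choose k) * ((-1) ^ (k - l) * real (k choose l)))
        = (\<Sum>k\<in>{l..b}. real (b choose k) * ((-1) ^ (k - l) * real (k choose l)))"
      by (rule sum.mono_neutral_right) (auto simp: binomial_eq_0)
    also have "\<dots> = (\<Sum>k\<in>{l..b}. real (b choose l) * ((-1) ^ (k - l) * real ((b - l) choose (k - l))))"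
    proof (rule sum.cong)
      fix k assume "k \<in> {l..b}"
      then have "real (b choose k) * real (k choose l) = real (b choose l) * real ((b - l) choose (k - l))"
        using choose_mult[of l k b] by (simp flip: of_nat_mult)
      then show "real (b choose k) * ((-1) ^ (k - l) * real (k choose l))
          = real (b choose l) * ((-1) ^ (k - l) * real ((b - l) choose (k - l)))"
        by (simp add: mult.left_commute)
    qed simp
    also have "\<dots> = (\<Sum>j\<le>b - l. real (b choose l) * ((-1) ^ j * real ((b - l) choose j)))"
      by (rule sum.reindex_bij_witness[of _ "\<lambda>j. j + l" "\<lambda>k. k - l"]) (use True in auto)
    also have "\<dots> = real (b choose l) * (\<Sum>j\<le>b - l. (-1) ^ j * real ((b - l) choose j))"
      by (simp add: sum_distrib_left)
    also have "\<dots> = of_bool (b = l)"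
      using choose_alternating_sum[of "b - l", where 'a=real] True by (cases "b = l") auto
    finally show ?thesis .
  qed
  finally show ?thesis by (simp add: b_def)
qed

section \<open>The maximum principle for the stirring operator\<close>

context boundary_driven_exclusion
begin

definition stirring :: "(('i \<Rightarrow> nat) \<Rightarrow> real) \<Rightarrow> ('i \<Rightarrow> nat) \<Rightarrow> real" where
  "stirring F X = (\<Sum>(x, y) \<in> {(x, y). x < y \<and> {x, y} \<in> E}. w x y * (F (swap x y \<circ> X) - F X))
     + wL * (F (id(1 := 0) \<circ> X) - F X) + wR * (F (id(N - 1 := N) \<circ> X) - F X)"

text \<open>
  One operator on labelled configurations describes all sub-families simultaneously; hence sums over
  sub-families of harmonic functions are again harmonic.
\<close>

lemma generator_occupation:
  assumes "finite A" "X \<in> labelled_configs N A" "I \<subseteq> A"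
  shows "dual_generator N E w wL wR f (occupation X I) = stirring (\<lambda>Y. f (occupation Y I)) X"
proof -
  have "finite I" using assms finite_subset by blast
  moreover have "N - 1 \<noteq> N" using N by simp
  ultimately show ?thesis
    unfolding stirring_def
    by (simp add: dual_generator_stirring[OF graph N occupation_in_dual_configs[OF assms]]
        occupation_swap occupation_absorb)
qed

lemma stirring_diff: "stirring (\<lambda>Y. F Y - G Y) X = stirring F X - stirring G X"
  unfolding stirring_def split_def by (simp add: algebra_simps sum.distrib sum_subtractf)

lemma stirring_scale: "stirring (\<lambda>Y. c * F Y) X = c * stirring F X"
  unfolding stirring_def split_def by (simp add: algebra_simps sum_distrib_left sum_subtractf)

lemma stirring_add: "stirring (\<lambda>Y. F Y + G Y) X = stirring F X + stirring G X"
  unfolding stirring_def split_def by (simp add: algebra_simps sum.distrib sum_subtractf)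

lemma stirring_sum:
  "stirring (\<lambda>Y. \<Sum>I\<in>S. c I * F I Y) X = (\<Sum>I\<in>S. c I * stirring (F I) X)"
proof (induction S rule: infinite_finite_induct)
  case (insert I S)
  then show ?case by (simp add: stirring_add stirring_scale)
qed (simp_all add: stirring_def)

lemma finite_edges: "finite {(x, y). x < y \<and> {x, y} \<in> E}"
  by (rule finite_subset[of _ "{1..N-1} \<times> {1..N-1}"]) (auto dest: edge_bulk)

text \<open>
  At a maximizer every summand of the stirring operator is nonpositive, so if their sum vanishes then each
  of them does.
\<close>

lemma stirring_maximizer:
  assumes harm: "stirring F X = 0" and X: "X \<in> labelled_configs N A"
    and max: "\<And>Y. Y \<in> labelled_configs N A \<Longrightarrow> F Y \<le> F X"
  shows "{x, y} \<in> E \<Longrightarrow> F (swap x y \<circ> X) = F X" and "F (id(1 := 0) \<circ> X) = F X"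
proof -
  let ?E = "{(x, y). x < y \<and> {x, y} \<in> E}" and ?g = "\<lambda>(x, y). w x y * (F (swap x y \<circ> X) - F X)"
  have wpos: "0 < w x y" if "{x, y} \<in> E" for x y
    using graph that by (auto simp: conductance_graph_def)
  have g: "?g e \<le> 0" if "e \<in> ?E" for e
  proof -
    obtain x y where e: "e = (x, y)" "{x, y} \<in> E" using \<open>e \<in> ?E\<close> by auto
    have "F (swap x y \<circ> X) \<le> F X"
      by (intro max swap_labelled_configs X edge_bulk[OF e(2)])
    then show ?thesis using e wpos[of x y] by (simp add: mult_le_0_iff)
  qed
  have L: "wL * (F (id(1 := 0) \<circ> X) - F X) \<le> 0"
    using wL N by (intro mult_nonneg_nonpos) (auto intro!: max absorb_labelled_configs X)
  have R: "wR * (F (id(N - 1 := N) \<circ> X) - F X) \<le> 0"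
    using wR N by (intro mult_nonneg_nonpos) (auto intro!: max absorb_labelled_configs X)
  have S: "sum ?g ?E \<le> 0" by (rule sum_nonpos) (rule g)
  have "wL * (F (id(1 := 0) \<circ> X) - F X) = 0" using harm L R S unfolding stirring_def by linarith
  then show "F (id(1 := 0) \<circ> X) = F X" using wL by simp
  have "sum ?g ?E = 0" using harm L R S unfolding stirring_def by linarith
  then have zero: "?g e = 0" if "e \<in> ?E" for e
  proof -
    have "(\<Sum>e\<in>?E. - ?g e) = 0" using \<open>sum ?g ?E = 0\<close> by (simp only: sum_negf minus_zero)
    moreover have "0 \<le> - ?g e" if "e \<in> ?E" for e using g[OF that] by linarith
    ultimately have "- ?g e = 0" using that sum_nonneg_0[OF finite_edges, of "\<lambda>e. - ?g e"] by blast
    then show ?thesis by linarith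
  qed
  assume xy: "{x, y} \<in> E"
  consider "x < y" | "y < x" using edge_bulk[OF xy] by linarith
  then show "F (swap x y \<circ> X) = F X"
  proof cases
    case 1 then show ?thesis using zero[of "(x, y)"] wpos[OF xy] xy by simp
  next
    case 2
    have yx: "{y, x} \<in> E" using xy by (simp add: insert_commute)
    then show ?thesis using 2 zero[of "(y, x)"] wpos[OF yx] by (simp add: Transposition.transpose_commute)
  qed
qed

text \<open>
  Among the maximizers choose one with the fewest particles in the bulk. If it had a particle in the
  bulk, this particle could be brought to site \<open>1\<close> along a path of the connected graph by interchanges,
  which preserve the number of bulk particles and lead from maximizers to maximizers; absorbing it
  at \<open>0\<close> would then give a maximizer with fewer bulk particles. So the maximum is attained at a
  configuration with all particles absorbed.
\<close>

lemma maximum_principle: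
  assumes A: "finite A" and X: "X \<in> labelled_configs N A"
    and harm: "\<And>Y. Y \<in> labelled_configs N A \<Longrightarrow> stirring F Y = 0"
    and boundary: "\<And>Y. Y \<in> labelled_configs N A \<Longrightarrow> Y ` A \<subseteq> {0, N} \<Longrightarrow> F Y \<le> 0"
  shows "F X \<le> 0"
proof -
  let ?K = "labelled_configs N A"
  define Mx where "Mx = {Y \<in> ?K. \<forall>Z\<in>?K. F Z \<le> F Y}"
  have same: "Y' \<in> Mx" if "Y \<in> Mx" "Y' \<in> ?K" "F Y' = F Y" for Y Y'
    using that by (auto simp: Mx_def)
  have swap: "swap x y \<circ> Y \<in> Mx" if Y: "Y \<in> Mx" and xy: "{x, y} \<in> E" for x y Y
    using Y stirring_maximizer(1)[OF harm _ _ xy, of Y A] swap_labelled_configs[OF edge_bulk(1,2)[OF xy]]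
    by (intro same[OF Y]) (auto simp: Mx_def)
  have absorb: "id(1 := 0) \<circ> Y \<in> Mx" if Y: "Y \<in> Mx" for Y
    using Y stirring_maximizer(2)[OF harm, of Y A] absorb_labelled_configs[of 1 N 0 Y A] N
    by (intro same[OF Y]) (auto simp: Mx_def)
  \<comment> \<open>Induction along a path in the graph from the position of the particle to site \<open>1\<close>.\<close>
  have fewer: "\<exists>Z\<in>Mx. card (bulk_labels N A Z) < card (bulk_labels N A Y)"
    if "(z, 1) \<in> {(a, b). {a, b} \<in> E}\<^sup>*" "Y \<in> Mx" "i \<in> A" "Y i = z" for z i Y
    using that
  proof (induction arbitrary: Y rule: converse_rtrancl_induct)
    case base
    have "bulk_labels N A (id(1 := 0) \<circ> Y) \<subseteq> bulk_labels N A Y - {i}"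
      using base by (auto simp: bulk_labels_def split: if_splits)
    moreover have "i \<in> bulk_labels N A Y" using base N by (auto simp: bulk_labels_def)
    moreover have "finite (bulk_labels N A Y)" using A by (simp add: bulk_labels_def)
    ultimately have "card (bulk_labels N A (id(1 := 0) \<circ> Y)) < card (bulk_labels N A Y)"
      by (intro psubset_card_mono) auto
    then show ?case using absorb[OF base(1)] by blast
  next
    case (step z y)
    then have e: "{z, y} \<in> E" by simp
    have "\<exists>Z\<in>Mx. card (bulk_labels N A Z) < card (bulk_labels N A (swap z y \<circ> Y))"
      using step by (intro step.IH swap e) auto
    then show ?case using bulk_labels_swap[OF edge_bulk(1,2)[OF e]] by metis
  qed
  have "Max (F ` ?K) \<in> F ` ?K" using finite_labelled_configs[OF A] X by (intro Max_in) auto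
  then obtain Y0 where "Y0 \<in> ?K" "F Y0 = Max (F ` ?K)" by (metis imageE)
  then have "Y0 \<in> Mx" using finite_labelled_configs[OF A] by (auto simp: Mx_def)
  then obtain Y where Y: "Y \<in> Mx"
    and least: "\<And>Z. Z \<in> Mx \<Longrightarrow> card (bulk_labels N A Y) \<le> card (bulk_labels N A Z)"
    using ex_has_least_nat[of "\<lambda>Z. Z \<in> Mx" Y0 "\<lambda>Z. card (bulk_labels N A Z)"] by blast
  have "Y ` A \<subseteq> {0, N}"
  proof (rule ccontr)
    assume "\<not> Y ` A \<subseteq> {0, N}"
    then obtain i where i: "i \<in> A" "Y i \<notin> {0, N}" by auto
    have "Y i \<le> N" using i Y by (auto simp: Mx_def labelled_configs_def)
    then have "Y i \<in> {1..N-1}" using i by auto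
    moreover have "1 \<in> {1..N-1}" using N by auto
    ultimately have "(Y i, 1) \<in> {(a, b). {a, b} \<in> E}\<^sup>*"
      using graph unfolding conductance_graph_def by blast
    from fewer[OF this Y i(1) refl] least show False by fastforce
  qed
  then have "F Y \<le> 0" using boundary Y by (auto simp: Mx_def)
  then show ?thesis using X Y by (force simp: Mx_def)
qed

lemma stirring_harmonic_unique:
  assumes A: "finite A" and X: "X \<in> labelled_configs N A"
    and F: "\<And>Y. Y \<in> labelled_configs N A \<Longrightarrow> stirring F Y = 0"
    and G: "\<And>Y. Y \<in> labelled_configs N A \<Longrightarrow> stirring G Y = 0"
    and boundary: "\<And>Y. Y \<in> labelled_configs N A \<Longrightarrow> Y ` A \<subseteq> {0, N} \<Longrightarrow> F Y = G Y"
  shows "F X = G X"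
proof (rule antisym)
  have "F X - G X \<le> 0"
    by (rule maximum_principle[OF A X]) (auto simp: stirring_diff F G boundary)
  then show "F X \<le> G X" by simp
  have "G X - F X \<le> 0"
    by (rule maximum_principle[OF A X]) (auto simp: stirring_diff F G boundary)
  then show "G X \<le> F X" by simp
qed

section \<open>Inclusion-exclusion for the absorbed particles\<close>

lemma absorption_prob_labelled_harmonic:
  assumes "finite A" "X \<in> labelled_configs N A" "I \<subseteq> A"
  shows "stirring (\<lambda>Y. absorption_prob k (occupation Y I)) X = 0"
  using generator_occupation[OF assms, of "absorption_prob k"]
    absorption_prob_harmonic[OF occupation_in_dual_configs[OF assms]] by simp

lemma absorption_prob_labelled_absorbed:
  assumes "finite A" "X \<in> labelled_configs N A" "I \<subseteq> A" "X ` A \<subseteq> {0, N}"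
  shows "absorption_prob k (occupation X I) = of_bool (card {i \<in> I. X i = N} = k)"
proof -
  have "occupation X I z = 0" if "z \<in> {1..N-1}" for z
  proof -
    have "X i \<noteq> z" if "i \<in> I" for i
    proof -
      have "X i \<in> {0, N}" using assms that by blast
      then show ?thesis using \<open>z \<in> {1..N-1}\<close> by auto
    qed
    then have "{i \<in> I. X i = z} = {}" by auto
    then show ?thesis unfolding occupation_def by (simp only: card.empty)
  qed
  from absorption_prob_absorbed[OF occupation_in_dual_configs[OF assms(1-3)] this]
  show ?thesis by (simp add: occupation_def indicator_def)
qed

text \<open>
  Both sides are harmonic for the stirring operator, so it suffices to compare them when all
  particles are absorbed. Then the left-hand side tells whether exactly \<open>l\<close> particles sit at \<open>N\<close>, and on the
  right-hand side only the sub-families contained in the set \<open>?B\<close> of particles at \<open>N\<close> survive; their signed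
  sum is the same indicator by the binomial identity.
\<close>

lemma absorption_prob_inclusion_exclusion:
  assumes A: "finite A" and X: "X \<in> labelled_configs N A"
  shows "absorption_prob l (occupation X A) =
    (\<Sum>I\<in>Pow A. (-1) ^ (card I - l) * real (card I choose l) * absorption_prob (card I) (occupation X I))"
proof (rule stirring_harmonic_unique[OF A X])
  fix Y assume Y: "Y \<in> labelled_configs N A"
  show "stirring (\<lambda>Y. absorption_prob l (occupation Y A)) Y = 0"
    by (rule absorption_prob_labelled_harmonic[OF A Y order_refl])
  show "stirring (\<lambda>Y. \<Sum>I\<in>Pow A. (-1) ^ (card I - l) * real (card I choose l)
      * absorption_prob (card I) (occupation Y I)) Y = 0"
    by (subst stirring_sum) (simp add: absorption_prob_labelled_harmonic[OF A Y])
  assume Yb: "Y ` A \<subseteq> {0, N}"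
  let ?B = "{i \<in> A. Y i = N}" and ?c = "\<lambda>I::'a set. (-1) ^ (card I - l) * real (card I choose l)"
  have "(\<Sum>I\<in>Pow A. ?c I * absorption_prob (card I) (occupation Y I)) = (\<Sum>I\<in>Pow A. ?c I * of_bool (I \<subseteq> ?B))"
  proof (rule sum.cong)
    fix I assume "I \<in> Pow A"
    then have I: "I \<subseteq> A" and "finite I" using A finite_subset by auto
    have "card {i \<in> I. Y i = N} = card I \<longleftrightarrow> I \<subseteq> ?B"
    proof
      assume "card {i \<in> I. Y i = N} = card I"
      then have "{i \<in> I. Y i = N} = I" using \<open>finite I\<close> by (intro card_subset_eq) auto
      then show "I \<subseteq> ?B" using I by auto
    next
      assume "I \<subseteq> ?B"
      then have "{i \<in> I. Y i = N} = I" by auto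
      then show "card {i \<in> I. Y i = N} = card I" by simp
    qed
    then show "?c I * absorption_prob (card I) (occupation Y I) = ?c I * of_bool (I \<subseteq> ?B)"
      by (simp add: absorption_prob_labelled_absorbed[OF A Y I Yb])
  qed simp
  also have "\<dots> = (\<Sum>I\<in>Pow ?B. ?c I)"
    using A by (intro sum.mono_neutral_cong_right) auto
  also have "\<dots> = of_bool (card ?B = l)"
    using A by (intro binomial_inversion_Pow) auto
  finally show "absorption_prob l (occupation Y A)
      = (\<Sum>I\<in>Pow A. ?c I * absorption_prob (card I) (occupation Y I))"
    by (simp add: absorption_prob_labelled_absorbed[OF A Y order_refl Yb])
qed

end

section \<open>Particles started from distinct sites\<close>

lemma occupation_inj_on:
  assumes "inj_on x I" "finite I"
  shows "occupation x I = indicator (x ` I)"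
proof
  fix z
  have "card {i \<in> I. x i = z} = card (x ` {i \<in> I. x i = z})"
    using assms by (intro card_image[symmetric]) (auto simp: inj_on_def)
  also have "x ` {i \<in> I. x i = z} = (if z \<in> x ` I then {z} else {})" by auto
  finally show "occupation x I z = indicator (x ` I) z"
    by (simp add: occupation_def indicator_def)
qed

theorem proposition1p5:
  fixes N n l :: nat
    and E :: "nat set set"
    and w :: "nat \<Rightarrow> nat \<Rightarrow> real"
    and wL wR :: real
    and P :: "config \<Rightarrow> 'w measure"
    and \<xi> :: "real \<Rightarrow> 'w \<Rightarrow> config"
    and x :: "nat \<Rightarrow> nat"
  assumes "N \<ge> 2"
    and "conductance_graph N E w"
    and "wL > 0" and "wR > 0"
    and "dual_exclusion_process N E w wL wR P \<xi>"
    and "strict_mono_on {1..n} x" and "x ` {1..n} \<subseteq> {1..N-1}"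
    and "l \<le> n"
  shows "\<P>(\<omega> in law_from P (x ` {1..n}). limit_config \<xi> \<omega> N = l) =
    (\<Sum>k=l..n. (-1) ^ (k - l) * real (k choose l) *
       (\<Sum>I \<in> {I. I \<subseteq> {1..n} \<and> card I = k}.
          \<P>(\<omega> in law_from P (x ` I). limit_config \<xi> \<omega> N = k)))"
proof -
  interpret boundary_driven_exclusion N E w wL wR P \<xi>
    by unfold_locales (use assms in auto)
  \<comment> \<open>The particle started at \<open>x i\<close> receives the label \<open>i\<close>; the other labels are parked at \<open>0\<close>.\<close>
  define X where "X i = (if i \<in> {1..n} then x i else 0)" for i
  have inj: "inj_on x {1..n}" using assms(6) by (rule strict_mono_on_imp_inj_on)
  have X: "X \<in> labelled_configs N {1..n}"
    unfolding labelled_configs_def mem_Collect_eq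
  proof (intro conjI allI ballI impI)
    fix i assume "i \<in> {1..n}"
    then have "x i \<in> {1..N-1}" using assms(7) by blast
    then have "x i \<le> N" by (meson atLeastAtMost_iff diff_le_self order_trans)
    then show "X i \<in> {..N}" using \<open>i \<in> {1..n}\<close> by (simp add: X_def)
  next
    fix i j assume "i \<in> {1..n}" "j \<in> {1..n}" "X i = X j"
    then show "i = j" using inj_onD[OF inj] by (simp add: X_def)
  next
    fix i assume "i \<notin> {1..n}"
    then show "X i = 0" unfolding X_def by (rule if_not_P)
  qed
  have law: "absorption_prob k (occupation X I) = \<P>(\<omega> in law_from P (x ` I). limit_config \<xi> \<omega> N = k)"
    if I: "I \<subseteq> {1..n}" for I k
  proof -
    have "occupation X I = occupation x I"
      using I unfolding occupation_def by (intro ext arg_cong[where f=card]) (auto simp: X_def)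
    also have "\<dots> = indicator (x ` I)"
      using I inj_on_subset[OF inj I] by (intro occupation_inj_on) (auto intro: finite_subset)
    finally show ?thesis by (simp add: absorption_prob_def law_from_def)
  qed
  let ?c = "\<lambda>k. (-1) ^ (k - l) * real (k choose l)"
  have "\<P>(\<omega> in law_from P (x ` {1..n}). limit_config \<xi> \<omega> N = l) =
      (\<Sum>I\<in>Pow {1..n}. ?c (card I) * absorption_prob (card I) (occupation X I))"
    using absorption_prob_inclusion_exclusion[OF _ X, of l] law[of "{1..n}" l] by simp
  also have "\<dots> = (\<Sum>k\<le>n. \<Sum>I | I \<subseteq> {1..n} \<and> card I = k.
      ?c (card I) * absorption_prob (card I) (occupation X I))"
    by (subst sum_Pow_by_card) auto
  also have "\<dots> = (\<Sum>k\<le>n. ?c k * (\<Sum>I | I \<subseteq> {1..n} \<and> card I = k.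
      \<P>(\<omega> in law_from P (x ` I). limit_config \<xi> \<omega> N = k)))"
    by (intro sum.cong) (auto simp: sum_distrib_left law intro!: sum.cong)
  also have "\<dots> = (\<Sum>k=l..n. ?c k * (\<Sum>I | I \<subseteq> {1..n} \<and> card I = k.
      \<P>(\<omega> in law_from P (x ` I). limit_config \<xi> \<omega> N = k)))"
    by (rule sum.mono_neutral_right) (auto simp: binomial_eq_0)
  finally show ?thesis by simp
qed

end
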